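(* Let $f:\mathbb{R}^n\to\mathbb{R}$ be differentiable and let $A$ be a real $m\times n$ matrix such that for all $x,h\in\mathbb{R}^n$, $$f(x+h)\le f(x)+\langle\nabla f(x),h\rangle+\tfrac12 h^\top A^\top A h .$$ For $j\in[m]$ let $J_j=\{i\in[n]:A_{ji}\neq0\}$. Then $(f,\hat S)\sim ESO(v)$ provided that the sampling $\hat S$ and the vector $v=(v_1,\dots,v_n)$ are chosen in any of the following ways (formulas for all $i=1,\dots,n$): (i) $\hat S$ is an arbitrary sampling such that $|\hat S|\le\tau$ with probability 1, and $v_i=\sum_{j=1}^m\min\{|J_j|,\tau\}A_{ji}^2$. (ii) $\hat S$ is the $(c,\tau)$-distributed sampling associated with a partition $\{\mathcal{P}_1,\dots,\mathcal{P}_c\}$ of $[n]$ with $|\mathcal{P}_l|=s$ for all $l$, and $$v_i=\sum_{j=1}^m\Big[1+\frac{(|J_j|-1)(\tau-1)}{s_1}+|J_j|\Big(\frac{\tau}{s}-\frac{\tau-1}{s_1}\Big)\frac{\omega_j'-1}{\omega_j'}\Big]A_{ji}^2,$$ where $s_1=\max(s-1,1)$ and $\omega'_j=|\{l:\mathcal{P}_l\cap J_j\neq\emptyset\}|$ for $j\in[m]$ (rows $j$ with $J_j=\emptyset$ contribute $0$). (iii) $\hat S$ is the $\tau$-nice sampling of $[n]$ (for $\tau\ge1$) and $$v_i=\sum_{j=1}^m\Big[1+\frac{(|J_j|-1)(\tau-1)}{\max(n-1,1)}\Big]A_{ji}^2.$$ (iv) $\hat S$ is a doubly uniform sampling which is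 not nil and $$v_i=\sum_{j=1}^m\Bigg[1+\frac{(|J_j|-1)\Big(\frac{\mathbf{E}[|\hat S|^2]}{\mathbf{E}[|\hat S|]}-1\Big)}{\max(n-1,1)}\Bigg]A_{ji}^2.$$ (v) $\hat S$ is a graph sampling and $v_i=\sum_{j=1}^mA_{ji}^2$. (vi) $\hat S$ is a serial sampling (i.e. $|\hat S|=1$ with probability 1) and $v_i=\sum_{j=1}^mA_{ji}^2$.
   Context: Let $[n]=\{1,\dots,n\}$ and $[m]=\{1,\dots,m\}$. A sampling $\hat S$ is a random subset of $[n]$; $p_i=\mathbf{P}(i\in\hat S)$. It is nil if $\mathbf{P}(\hat S=\emptyset)=1$. For a differentiable $f:\mathbb{R}^n\to\mathbb{R}$ and a sampling $\hat S$, one says that $f$ admits an expected separable overapproximation (ESO) with respect to $\hat S$ with parameters $v=(v_1,\dots,v_n)>0$ (all entries positive), written $(f,\hat S)\sim ESO(v)$, if for all $x,h\in\mathbb{R}^n$, $$\mathbf{E}\Big[f\Big(x+\sum_{i\in\hat S}h_ie_i\Big)\Big]\le f(x)+\sum_{i=1}^n p_i\,\nabla_i f(x)\,h_i+\frac12\sum_{i=1}^n p_iv_ih_i^2,$$ where $e_i$ is the $i$-th standard basis vector and $\nabla_i f$ the $i$-th partial derivative. Special samplings: The $\tau$-nice sampling of a finite set $X$ ($1\le\tau\le|X|$) picks a subset of $X$ of cardinality $\tau$ uniformly at random. Given a partition $\mathcal{P}_1,\dots,\mathcal{P}_c$ of $[n]$ with $|\mathcal{P}_l|=s$ for all $l$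 (so $sc=n$) and $1\le\tau\le s$, the $(c,\tau)$-distributed sampling is $\hat S=\bigcup_{l=1}^c\hat S_l$ where $\hat S_1,\dots,\hat S_c$ are independent and $\hat S_l$ is the $\tau$-nice sampling of $\mathcal{P}_l$. $\hat S$ is doubly uniform if $|S_1|=|S_2|$ implies $\mathbf{P}(\hat S=S_1)=\mathbf{P}(\hat S=S_2)$. Let $G$ be the undirected graph with vertex set $[n]$ in which distinct $i,i'$ are adjacent iff there is $j\in[m]$ with $\{i,i'\}\subseteq J_j$; a graph sampling is any sampling with $\mathbf{P}(\hat S=S)=0$ whenever $S$ is not an independent set of $G$.
   Formalization: If column i of A is zero (or τ=0 in (i)) the formulas give v_i=0, so v>0 fails; the formal theorem proves the ESO inequality in all cases, and the full ESO(v) with v>0 when A has no zero column (and τ≥1 in (i)). *)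

theory Defs
  imports "HOL-Probability.Probability"
begin

text \<open>
  The index sets \<open>[n]\<close> and \<open>[m]\<close> are finite types \<open>'n\<close> and \<open>'m\<close>; the matrix entry
  \<open>A\<^sub>j\<^sub>i\<close> is \<open>A $ j $ i\<close>. A sampling is given by its law, a pmf on \<open>'n set\<close>;
  everything below depends on the random set only through that law.
\<close>

definition partial :: "(real ^ 'n \<Rightarrow> real) \<Rightarrow> 'n \<Rightarrow> real ^ 'n \<Rightarrow> real" where
  "partial f i x = deriv (\<lambda>t. f (x + t *\<^sub>R axis i 1)) 0"

definition grad :: "(real ^ 'n \<Rightarrow> real) \<Rightarrow> real ^ 'n \<Rightarrow> real ^ 'n" where
  "grad f x = (\<chi> i. partial f i x)"

definition incl_prob :: "'n set pmf \<Rightarrow> 'n \<Rightarrow> real" where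
  "incl_prob S i = measure_pmf.prob S {T. i \<in> T}"

definition nil_sampling :: "'n set pmf \<Rightarrow> bool" where
  "nil_sampling S \<longleftrightarrow> measure_pmf.prob S {T. T = {}} = 1"

text \<open>
  The positivity \<open>v > 0\<close> is part of \<open>ESO\<close>. The inequality is also named separately because
  a zero column \<open>i\<close> of \<open>A\<close> makes the usual formulas give \<open>v $ i = 0\<close>, where only the
  inequality can hold.
\<close>

definition ESO_inequality ::
    "(real ^ 'n \<Rightarrow> real) \<Rightarrow> ('n::finite) set pmf \<Rightarrow> real ^ 'n \<Rightarrow> bool" where
  "ESO_inequality f S v \<longleftrightarrow>
     (\<forall>x h. measure_pmf.expectation S (\<lambda>T. f (x + (\<Sum>i\<in>T. h $ i *\<^sub>R axis i 1)))
        \<le> f x + (\<Sum>i\<in>UNIV. incl_prob S i * grad f x $ i * h $ i)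
            + 1 / 2 * (\<Sum>i\<in>UNIV. incl_prob S i * v $ i * (h $ i)\<^sup>2))"

definition ESO ::
    "(real ^ 'n \<Rightarrow> real) \<Rightarrow> ('n::finite) set pmf \<Rightarrow> real ^ 'n \<Rightarrow> bool" where
  "ESO f S v \<longleftrightarrow> (\<forall>i. v $ i > 0) \<and> ESO_inequality f S v"

definition nice_sampling :: "'n set \<Rightarrow> nat \<Rightarrow> 'n set pmf" where
  "nice_sampling X \<tau> = pmf_of_set {T. T \<subseteq> X \<and> card T = \<tau>}"

definition equal_partition :: "nat \<Rightarrow> nat \<Rightarrow> (nat \<Rightarrow> 'n set) \<Rightarrow> bool" where
  "equal_partition c s P \<longleftrightarrow>
     disjoint_family_on P {1..c} \<and> (\<Union>l\<in>{1..c}. P l) = UNIV \<and> (\<forall>l\<in>{1..c}. card (P l) = s)"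

text \<open>The product law \<open>Pi_pmf\<close> makes the \<open>c\<close> nice samplings independent; \<open>{}\<close> is only the
  irrelevant value of the family outside \<open>{1..c}\<close>.\<close>

definition distributed_sampling :: "nat \<Rightarrow> (nat \<Rightarrow> 'n set) \<Rightarrow> nat \<Rightarrow> 'n set pmf" where
  "distributed_sampling c P \<tau> =
     map_pmf (\<lambda>F. \<Union>l\<in>{1..c}. F l) (Pi_pmf {1..c} {} (\<lambda>l. nice_sampling (P l) \<tau>))"

definition doubly_uniform :: "'n set pmf \<Rightarrow> bool" where
  "doubly_uniform S \<longleftrightarrow> (\<forall>S1 S2. card S1 = card S2 \<longrightarrow> pmf S S1 = pmf S S2)"

definition row_supp :: "real ^ 'n ^ 'm \<Rightarrow> 'm \<Rightarrow> 'n set" where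
  "row_supp A j = {i. A $ j $ i \<noteq> 0}"

definition adjacent :: "real ^ 'n ^ 'm \<Rightarrow> 'n \<Rightarrow> 'n \<Rightarrow> bool" where
  "adjacent A i i' \<longleftrightarrow> i \<noteq> i' \<and> (\<exists>j. {i, i'} \<subseteq> row_supp A j)"

definition independent_set :: "real ^ 'n ^ 'm \<Rightarrow> 'n set \<Rightarrow> bool" where
  "independent_set A T \<longleftrightarrow> (\<forall>i\<in>T. \<forall>i'\<in>T. \<not> adjacent A i i')"

definition graph_sampling :: "real ^ 'n ^ 'm \<Rightarrow> 'n set pmf \<Rightarrow> bool" where
  "graph_sampling A S \<longleftrightarrow> (\<forall>T. \<not> independent_set A T \<longrightarrow> pmf S T = 0)"

definition serial_sampling :: "'n set pmf \<Rightarrow> bool" where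
  "serial_sampling S \<longleftrightarrow> measure_pmf.prob S {T. card T = 1} = 1"

text \<open>The parameter vectors of the six cases. All subtractions are real subtractions. In
  \<open>v_distributed\<close>, rows with empty support contribute \<open>0\<close> because \<open>A $ j $ i = 0\<close> there.\<close>

definition v_bounded :: "real ^ 'n ^ 'm \<Rightarrow> nat \<Rightarrow> real ^ 'n" where
  "v_bounded A \<tau> = (\<chi> i. \<Sum>j\<in>UNIV. min (real (card (row_supp A j))) (real \<tau>) * (A $ j $ i)\<^sup>2)"

definition parts_hit :: "real ^ 'n ^ 'm \<Rightarrow> nat \<Rightarrow> (nat \<Rightarrow> 'n set) \<Rightarrow> 'm \<Rightarrow> nat" where
  "parts_hit A c P j = card {l \<in> {1..c}. P l \<inter> row_supp A j \<noteq> {}}"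

definition v_distributed ::
    "real ^ 'n ^ 'm \<Rightarrow> nat \<Rightarrow> nat \<Rightarrow> (nat \<Rightarrow> 'n set) \<Rightarrow> nat \<Rightarrow> real ^ 'n" where
  "v_distributed A c s P \<tau> = (\<chi> i. \<Sum>j\<in>UNIV.
     (let s1 = max (real s - 1) 1;
          w = real (card (row_supp A j));
          w' = real (parts_hit A c P j)
      in 1 + (w - 1) * (real \<tau> - 1) / s1
           + w * (real \<tau> / real s - (real \<tau> - 1) / s1) * ((w' - 1) / w')) * (A $ j $ i)\<^sup>2)"

definition v_nice :: "real ^ 'n ^ 'm \<Rightarrow> nat \<Rightarrow> real ^ 'n" where
  "v_nice A \<tau> = (\<chi> i. \<Sum>j\<in>UNIV.
     (1 + (real (card (row_supp A j)) - 1) * (real \<tau> - 1) / max (real CARD('n) - 1) 1)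
       * (A $ j $ i)\<^sup>2)"

definition v_doubly_uniform :: "real ^ 'n ^ 'm \<Rightarrow> 'n set pmf \<Rightarrow> real ^ 'n" where
  "v_doubly_uniform A S = (\<chi> i. \<Sum>j\<in>UNIV.
     (1 + (real (card (row_supp A j)) - 1)
            * (measure_pmf.expectation S (\<lambda>T. (real (card T))\<^sup>2)
                 / measure_pmf.expectation S (\<lambda>T. real (card T)) - 1)
            / max (real CARD('n) - 1) 1)
       * (A $ j $ i)\<^sup>2)"

definition v_column :: "real ^ 'n ^ 'm \<Rightarrow> real ^ 'n" where
  "v_column A = (\<chi> i. \<Sum>j\<in>UNIV. (A $ j $ i)\<^sup>2)"

end

theory Submission
  imports Defs
begin

text \<open>
  Let \<open>h\<^sub>S\<close> be \<open>h\<close> with the coordinates outside the random set \<open>S\<close> set to zero. The curvature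
  assumption at \<open>h\<^sub>S\<close> has a linear term with expectation \<open>\<Sum>\<^sub>i p\<^sub>i \<nabla>\<^sub>i f(x) h\<^sub>i\<close> and the quadratic term
  \<open>\<parallel>A h\<^sub>S\<parallel>\<^sup>2 = \<Sum>\<^sub>j (\<Sum>\<^bsub>i\<in>S\<^esub> A\<^sub>j\<^sub>i h\<^sub>i)\<^sup>2\<close>, so the problem splits over the rows of \<open>A\<close>. If every row
  support \<open>J\<^sub>j\<close> has a constant \<open>b\<^sub>j\<close> such that \<open>E (\<Sum>\<^bsub>i\<in>S\<^esub> a\<^sub>i)\<^sup>2 \<le> b\<^sub>j \<Sum>\<^sub>i p\<^sub>i a\<^sub>i\<^sup>2\<close> for all vectors
  \<open>a\<close> vanishing outside \<open>J\<^sub>j\<close> (\<open>overlap_bound\<close>), then \<open>v\<^sub>i = \<Sum>\<^sub>j b\<^sub>j A\<^sub>j\<^sub>i\<^sup>2\<close> satisfies the inequality, and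
  it is positive on nonzero columns once \<open>b\<^sub>j > 0\<close> for nonempty rows (\<open>ESO_of_overlap_bounds\<close>).

  The constants come from two sources. If \<open>|S \<inter> J| \<le> b\<close> almost surely, Cauchy--Schwarz on
  \<open>S \<inter> J\<close> gives the constant \<open>b\<close> (\<open>overlap_bound_of_card_inter_le\<close>); this settles samplings of
  bounded size, graph samplings and serial samplings. For the other samplings,
  \<open>E (\<Sum>\<^bsub>i\<in>S\<^esub> a\<^sub>i)\<^sup>2\<close> is the quadratic form whose matrix has the entries \<open>P(i \<in> S, k \<in> S)\<close>. These
  take only three values with respect to a partition of the indices: \<open>p\<close> on the diagonal, \<open>q\<close> for
  two indices of one block, \<open>r\<close> for indices of two blocks. With \<open>\<beta>\<^sub>l\<close> the sum of \<open>a\<close> over block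
  \<open>l\<close>, the form is
    \<open>(p - q) \<Sum> a\<^sub>i\<^sup>2 + r (\<Sum> a\<^sub>i)\<^sup>2 - (r - q) \<Sum>\<^sub>l \<beta>\<^sub>l\<^sup>2\<close>.
  Since \<open>q \<le> r\<close>, two applications of Cauchy--Schwarz bound it: the block sums satisfy
  \<open>(\<Sum> a\<^sub>i)\<^sup>2 \<le> w' \<Sum>\<^sub>l \<beta>\<^sub>l\<^sup>2\<close> where \<open>w'\<close> is the number of blocks that meet \<open>J\<close>, and
  \<open>(\<Sum> a\<^sub>i)\<^sup>2 \<le> |J| \<Sum> a\<^sub>i\<^sup>2\<close> (\<open>overlap_bound_blocks\<close>).

  A distributed sampling has \<open>r = p\<^sup>2\<close> by independence. A doubly uniform sampling is the case of
  a single block. In both, \<open>p\<close> and \<open>q\<close> follow by symmetry from the first two moments of the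
  cardinality, because a law that depends on cardinalities only is invariant under permutations
  (\<open>exchangeable_incl_prob\<close>, \<open>exchangeable_pair_prob\<close>). The \<open>\<tau>\<close>-nice sampling is the doubly
  uniform sampling of constant cardinality \<open>\<tau>\<close>.
\<close>

section \<open>Moments of sums over a random set\<close>

lemma integrable_sampling [simp]:
  fixes S :: "'n::finite set pmf" and g :: "'n set \<Rightarrow> real"
  shows "integrable (measure_pmf S) g"
  by (rule integrable_measure_pmf_finite) simp

lemma sum_sampled_eq_indicator:
  fixes T :: "'n::finite set" and a :: "'n \<Rightarrow> real"
  shows "(\<Sum>i\<in>T. a i) = (\<Sum>i\<in>UNIV. indicator {T. i \<in> T} T * a i)"
  by (simp add: indicator_def if_distrib[of "\<lambda>z. z * _"] sum.If_cases cong: if_cong)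

definition pair_prob :: "'n set pmf \<Rightarrow> 'n \<Rightarrow> 'n \<Rightarrow> real" where
  "pair_prob S i k = measure_pmf.prob S {T. i \<in> T \<and> k \<in> T}"

lemma pair_prob_diagonal: "pair_prob S i i = incl_prob S i"
  by (simp add: pair_prob_def incl_prob_def)

lemma expectation_sum_sampled:
  fixes S :: "'n::finite set pmf" and a :: "'n \<Rightarrow> real"
  shows "measure_pmf.expectation S (\<lambda>T. \<Sum>i\<in>T. a i) = (\<Sum>i\<in>UNIV. incl_prob S i * a i)"
proof -
  have "measure_pmf.expectation S (\<lambda>T. \<Sum>i\<in>T. a i)
      = (\<Sum>i\<in>UNIV. measure_pmf.expectation S (\<lambda>T. indicator {T. i \<in> T} T * a i))"
    unfolding sum_sampled_eq_indicator[of a] by (rule Bochner_Integration.integral_sum) simp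
  then show ?thesis
    by (simp add: incl_prob_def)
qed

lemma expectation_sum_sampled_squared:
  fixes S :: "'n::finite set pmf" and a :: "'n \<Rightarrow> real"
  shows "measure_pmf.expectation S (\<lambda>T. (\<Sum>i\<in>T. a i)\<^sup>2) =
    (\<Sum>i\<in>UNIV. \<Sum>k\<in>UNIV. pair_prob S i k * (a i * a k))"
proof -
  have "(\<Sum>i\<in>T. a i)\<^sup>2 =
      (\<Sum>i\<in>UNIV. \<Sum>k\<in>UNIV. indicator {T. i \<in> T \<and> k \<in> T} T * (a i * a k))" for T
    unfolding sum_sampled_eq_indicator[of a] power2_eq_square sum_product
    by (intro sum.cong refl) (auto simp: indicator_def)
  then have "measure_pmf.expectation S (\<lambda>T. (\<Sum>i\<in>T. a i)\<^sup>2) =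
      (\<Sum>i\<in>UNIV. \<Sum>k\<in>UNIV. measure_pmf.expectation S
         (\<lambda>T. indicator {T. i \<in> T \<and> k \<in> T} T * (a i * a k)))"
    by (simp only: Bochner_Integration.integral_sum integrable_sampling)
  then show ?thesis
    by (simp add: pair_prob_def)
qed


section \<open>Reduction of the overapproximation to one row at a time\<close>

text \<open>
  In matrix terms: on the indices in \<open>J\<close>, the matrix of pair probabilities is at most \<open>b\<close> times its
  diagonal part in the Loewner order. In the application \<open>J\<close> is the support of a row of \<open>A\<close>, and
  \<open>a\<close> is the entrywise product of that row with \<open>h\<close>.
\<close>

definition overlap_bound :: "'n::finite set pmf \<Rightarrow> 'n set \<Rightarrow> real \<Rightarrow> bool" where
  "overlap_bound S J b \<longleftrightarrow>
     (\<forall>a. (\<forall>i. i \<notin> J \<longrightarrow> a i = 0) \<longrightarrow>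
        measure_pmf.expectation S (\<lambda>T. (\<Sum>i\<in>T. a i)\<^sup>2) \<le> b * (\<Sum>i\<in>UNIV. incl_prob S i * (a i)\<^sup>2))"

lemma overlap_bound_empty: "overlap_bound S {} b"
  by (simp add: overlap_bound_def)

text \<open>
  Expanding \<open>\<parallel>A h\<^sub>S\<parallel>\<^sup>2\<close> over the rows turns the expected quadratic term into a sum of second
  moments, one for each row; each is bounded separately, and exchanging the sums over \<open>j\<close> and
  \<open>i\<close> collects the coefficient of \<open>p\<^sub>i h\<^sub>i\<^sup>2\<close>.
\<close>

lemma ESO_inequality_of_overlap_bounds:
  fixes f :: "real ^ 'n \<Rightarrow> real" and A :: "real ^ 'n ^ 'm" and S :: "'n set pmf"
  assumes smooth: "\<And>x h. f (x + h) \<le> f x + grad f x \<bullet> h + 1 / 2 * (h \<bullet> ((transpose A ** A) *v h))"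
    and bound: "\<And>j. overlap_bound S (row_supp A j) (b j)"
  shows "ESO_inequality f S (\<chi> i. \<Sum>j\<in>UNIV. b j * (A $ j $ i)\<^sup>2)"
  unfolding ESO_inequality_def
proof (intro allI)
  fix x h :: "real ^ 'n"
  define hs where "hs T = (\<Sum>i\<in>T. h $ i *\<^sub>R (axis i 1 :: real ^ 'n))" for T
  have lin: "grad f x \<bullet> hs T = (\<Sum>i\<in>T. grad f x $ i * h $ i)" for T
    by (simp add: hs_def inner_sum_right inner_axis mult.commute)
  have row: "(A *v hs T) $ j = (\<Sum>i\<in>T. A $ j $ i * h $ i)" for T j
    by (simp add: hs_def matrix_vector_mul_component inner_sum_right inner_axis mult.commute)
  have quad: "hs T \<bullet> ((transpose A ** A) *v hs T) = (\<Sum>j\<in>UNIV. (\<Sum>i\<in>T. A $ j $ i * h $ i)\<^sup>2)" for T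
  proof -
    have "hs T \<bullet> ((transpose A ** A) *v hs T) = (A *v hs T) \<bullet> (A *v hs T)"
      by (metis dot_lmul_matrix matrix_vector_mul_assoc transpose_matrix_vector transpose_transpose)
    also have "\<dots> = (\<Sum>j\<in>UNIV. (\<Sum>i\<in>T. A $ j $ i * h $ i)\<^sup>2)"
      unfolding inner_vec_def row by (simp add: power2_eq_square)
    finally show ?thesis .
  qed
  have "measure_pmf.expectation S (\<lambda>T. f (x + hs T))
      \<le> measure_pmf.expectation S (\<lambda>T. f x + (\<Sum>i\<in>T. grad f x $ i * h $ i)
            + 1 / 2 * (\<Sum>j\<in>UNIV. (\<Sum>i\<in>T. A $ j $ i * h $ i)\<^sup>2))"
    using smooth[of x] unfolding lin[symmetric] quad[symmetric]
    by (intro integral_mono integrable_sampling) simp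
  also have "\<dots> = f x + (\<Sum>i\<in>UNIV. incl_prob S i * (grad f x $ i * h $ i))
      + 1 / 2 * (\<Sum>j\<in>UNIV. measure_pmf.expectation S (\<lambda>T. (\<Sum>i\<in>T. A $ j $ i * h $ i)\<^sup>2))"
    by (simp add: expectation_sum_sampled)
  also have "(\<Sum>j\<in>UNIV. measure_pmf.expectation S (\<lambda>T. (\<Sum>i\<in>T. A $ j $ i * h $ i)\<^sup>2))
      \<le> (\<Sum>j\<in>UNIV. b j * (\<Sum>i\<in>UNIV. incl_prob S i * (A $ j $ i * h $ i)\<^sup>2))"
    using bound by (intro sum_mono) (auto simp: overlap_bound_def row_supp_def)
  also have "\<dots> = (\<Sum>i\<in>UNIV. incl_prob S i * (\<Sum>j\<in>UNIV. b j * (A $ j $ i)\<^sup>2) * (h $ i)\<^sup>2)"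
    unfolding sum_distrib_left sum_distrib_right
    by (subst sum.swap) (intro sum.cong refl, simp add: power_mult_distrib)
  finally show "measure_pmf.expectation S (\<lambda>T. f (x + (\<Sum>i\<in>T. h $ i *\<^sub>R axis i 1)))
      \<le> f x + (\<Sum>i\<in>UNIV. incl_prob S i * grad f x $ i * h $ i)
        + 1 / 2 * (\<Sum>i\<in>UNIV. incl_prob S i * (\<chi> i. \<Sum>j\<in>UNIV. b j * (A $ j $ i)\<^sup>2) $ i * (h $ i)\<^sup>2)"
    by (simp add: hs_def mult.assoc)
qed

text \<open>
  Positivity is asked for nonempty rows only, because the weight of an empty row can be zero, as for
  samplings of bounded size; such a row contributes nothing to any column.
\<close>

lemma weighted_column_pos:
  fixes A :: "real ^ 'n ^ 'm"
  assumes pos: "\<And>j. row_supp A j \<noteq> {} \<Longrightarrow> b j > 0" and "column i A \<noteq> 0"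
  shows "(\<Sum>j\<in>UNIV. b j * (A $ j $ i)\<^sup>2) > 0"
proof -
  obtain j where j: "A $ j $ i \<noteq> 0"
    using \<open>column i A \<noteq> 0\<close> by (auto simp: column_def vec_eq_iff)
  have supp: "A $ j $ i \<noteq> 0 \<Longrightarrow> b j > 0" for j
    using pos[of j] by (auto simp: row_supp_def)
  show ?thesis
  proof (rule sum_pos2[of UNIV j])
    show "0 < b j * (A $ j $ i)\<^sup>2"
      using supp[OF j] j by simp
    show "0 \<le> b j * (A $ j $ i)\<^sup>2" for j
      using supp[of j] by (cases "A $ j $ i = 0") auto
  qed simp_all
qed

lemma ESO_of_overlap_bounds:
  fixes f :: "real ^ 'n \<Rightarrow> real" and A :: "real ^ 'n ^ 'm" and S :: "'n set pmf"
  assumes smooth: "\<And>x h. f (x + h) \<le> f x + grad f x \<bullet> h + 1 / 2 * (h \<bullet> ((transpose A ** A) *v h))"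
    and bound: "\<And>j. overlap_bound S (row_supp A j) (b j)"
    and v: "v = (\<chi> i. \<Sum>j\<in>UNIV. b j * (A $ j $ i)\<^sup>2)"
  shows "ESO_inequality f S v"
    and "(\<And>j. row_supp A j \<noteq> {} \<Longrightarrow> b j > 0) \<Longrightarrow> \<forall>i. column i A \<noteq> 0 \<Longrightarrow> ESO f S v"
  using ESO_inequality_of_overlap_bounds[OF smooth bound] weighted_column_pos[of A b]
  by (auto simp: ESO_def v)


section \<open>Samplings that meet each row support in few points\<close>

text \<open>
  For each realisation \<open>T\<close> of the sampling, Cauchy--Schwarz over \<open>T \<inter> J\<close> already gives the
  inequality before expectations are taken.
\<close>

lemma overlap_bound_of_card_inter_le:
  fixes S :: "'n::finite set pmf"
  assumes card: "\<And>T. T \<in> set_pmf S \<Longrightarrow> real (card (T \<inter> J)) \<le> b"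
  shows "overlap_bound S J b"
  unfolding overlap_bound_def
proof (intro allI impI)
  fix a :: "'n \<Rightarrow> real" assume a: "\<forall>i. i \<notin> J \<longrightarrow> a i = 0"
  have "(\<Sum>i\<in>T. a i)\<^sup>2 \<le> b * (\<Sum>i\<in>T. (a i)\<^sup>2)" if "T \<in> set_pmf S" for T
  proof -
    have "(\<Sum>i\<in>T. a i)\<^sup>2 = (\<Sum>i\<in>T \<inter> J. a i)\<^sup>2"
      using a by (intro arg_cong[where f = "\<lambda>z. z\<^sup>2"] sum.mono_neutral_right) auto
    also have "\<dots> \<le> (\<Sum>i\<in>T \<inter> J. (a i)\<^sup>2) * real (card (T \<inter> J))"
      by (rule sum_squared_le_sum_of_squares)
    also have "\<dots> \<le> (\<Sum>i\<in>T \<inter> J. (a i)\<^sup>2) * b"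
      by (intro mult_left_mono card that sum_nonneg) simp
    also have "(\<Sum>i\<in>T \<inter> J. (a i)\<^sup>2) = (\<Sum>i\<in>T. (a i)\<^sup>2)"
      using a by (intro sum.mono_neutral_left) auto
    finally show ?thesis by (simp add: mult.commute)
  qed
  then have "measure_pmf.expectation S (\<lambda>T. (\<Sum>i\<in>T. a i)\<^sup>2)
      \<le> measure_pmf.expectation S (\<lambda>T. b * (\<Sum>i\<in>T. (a i)\<^sup>2))"
    by (intro integral_mono_AE integrable_sampling) (simp add: AE_measure_pmf_iff)
  then show "measure_pmf.expectation S (\<lambda>T. (\<Sum>i\<in>T. a i)\<^sup>2) \<le> b * (\<Sum>i\<in>UNIV. incl_prob S i * (a i)\<^sup>2)"
    by (simp add: expectation_sum_sampled)
qed

lemma prob_eq_1_support: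
  "measure_pmf.prob S {T. Q T} = 1 \<longleftrightarrow> (\<forall>T\<in>set_pmf S. Q T)"
  by (subst measure_pmf.prob_eq_1) (auto simp: AE_measure_pmf_iff)

text \<open>
  Two indices in the support of one row are adjacent, so an independent set contains at most one.
\<close>

lemma overlap_bound_graph_sampling:
  fixes A :: "real ^ 'n ^ 'm"
  assumes "graph_sampling A S"
  shows "overlap_bound S (row_supp A j) 1"
proof (rule overlap_bound_of_card_inter_le)
  fix T assume "T \<in> set_pmf S"
  then have "independent_set A T"
    using assms by (auto simp: graph_sampling_def set_pmf_iff)
  then have "i = k" if "i \<in> T \<inter> row_supp A j" "k \<in> T \<inter> row_supp A j" for i k
    using that by (auto simp: independent_set_def adjacent_def)
  then have "card (T \<inter> row_supp A j) \<le> Suc 0"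
    by (subst card_le_Suc0_iff_eq) auto
  then show "real (card (T \<inter> row_supp A j)) \<le> 1" by simp
qed


section \<open>Samplings with block-constant pair probabilities\<close>

text \<open>
  The assumption on \<open>b\<close> is stated in the form \<open>p * b = \<dots>\<close> because the sum weighted by inclusion
  probabilities is \<open>p \<Sum> a\<^sub>i\<^sup>2\<close> here. The block sums enter with the negative coefficient \<open>q - r\<close>, so
  they have to be bounded from below, and only the blocks that meet \<open>J\<close> can contribute.
\<close>

lemma overlap_bound_blocks:
  fixes S :: "'n::finite set pmf" and P :: "nat \<Rightarrow> 'n set"
  assumes part: "equal_partition c s P"
    and incl: "\<And>i. incl_prob S i = p"
    and same: "\<And>i k l. \<lbrakk>i \<noteq> k; l \<in> {1..c}; i \<in> P l; k \<in> P l\<rbrakk> \<Longrightarrow> pair_prob S i k = q"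
    and diff: "\<And>i k l l'. \<lbrakk>l \<noteq> l'; l \<in> {1..c}; l' \<in> {1..c}; i \<in> P l; k \<in> P l'\<rbrakk> \<Longrightarrow> pair_prob S i k = r"
    and qr: "0 \<le> q" "q \<le> r"
    and hit: "w' = real (card {l \<in> {1..c}. P l \<inter> J \<noteq> {}})"
    and b: "p * b = p - q + real (card J) * (r - (r - q) / w')"
    and "J \<noteq> {}"
  shows "overlap_bound S J b"
  unfolding overlap_bound_def
proof (intro allI impI)
  fix a :: "'n \<Rightarrow> real" assume a: "\<forall>i. i \<notin> J \<longrightarrow> a i = 0"
  define H where "H = {l \<in> {1..c}. P l \<inter> J \<noteq> {}}"
  define B where "B = (\<Sum>l\<in>{1..c}. (\<Sum>i\<in>P l. a i)\<^sup>2)"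
  define C where "C = (\<Sum>i\<in>UNIV. (a i)\<^sup>2)"
  have cover: "(\<Union>l\<in>{1..c}. P l) = UNIV" and disj: "disjoint_family_on P {1..c}"
    using part by (auto simp: equal_partition_def)
  have uniq: "m = l" if "m \<in> {1..c}" "l \<in> {1..c}" "h \<in> P m" "h \<in> P l" for m l h
    using disj that unfolding disjoint_family_on_def by blast
  have "H \<noteq> {}"
    using \<open>J \<noteq> {}\<close> cover unfolding H_def by blast
  then have w': "w' \<ge> 1"
    unfolding hit H_def[symmetric] by (simp add: H_def Suc_le_eq card_gt_0_iff)
  \<comment> \<open>The sum over \<open>l\<close> is 1 or 0 according to whether \<open>i\<close> and \<open>k\<close> share a block; in this form the
    double sum of pair probabilities separates.\<close>
  have pair: "pair_prob S i k =
      r + (q - r) * (\<Sum>l\<in>{1..c}. indicator (P l) i * indicator (P l) k) + (p - q) * of_bool (i = k)" for i k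
  proof -
    obtain l l' where l: "l \<in> {1..c}" "i \<in> P l" "l' \<in> {1..c}" "k \<in> P l'"
      using cover by blast
    have "i \<in> P m \<longleftrightarrow> m = l" if "m \<in> {1..c}" for m
      using uniq[of m l i] l that by blast
    then have "(\<Sum>m\<in>{1..c}. indicator (P m) i * indicator (P m) k :: real) =
        (\<Sum>m\<in>{1..c}. if m = l then indicator (P l) k else 0)"
      by (intro sum.cong) (simp_all add: indicator_def)
    also have "\<dots> = indicator (P l) k"
      using l by simp
    also have "\<dots> = of_bool (l = l')"
      using uniq[of l l' k] l by (cases "l = l'") (auto simp: indicator_def)
    finally have count: "(\<Sum>m\<in>{1..c}. indicator (P m) i * indicator (P m) k) = (of_bool (l = l') :: real)" .
    consider "i = k" "l = l'" | "i \<noteq> k" "l = l'" | "i \<noteq> k" "l \<noteq> l'"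
      using uniq[of l l' k] l by blast
    then show ?thesis
      unfolding count using same[of i k l] diff[of l l' i k] incl[of i] l
      by cases (simp_all add: pair_prob_diagonal)
  qed
  have block: "(\<Sum>i\<in>UNIV. indicator (P l) i * a i) = (\<Sum>i\<in>P l. a i)" for l
    by (simp add: indicator_def if_distrib[of "\<lambda>z. z * _"] sum.If_cases cong: if_cong)
  have "measure_pmf.expectation S (\<lambda>T. (\<Sum>i\<in>T. a i)\<^sup>2)
      = (\<Sum>i\<in>UNIV. \<Sum>k\<in>UNIV. r * (a i * a k)
          + (q - r) * (\<Sum>l\<in>{1..c}. (indicator (P l) i * a i) * (indicator (P l) k * a k))
          + (p - q) * (of_bool (i = k) * (a i * a k)))"
    unfolding expectation_sum_sampled_squared
  proof (intro sum.cong refl)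
    fix i k
    have "(\<Sum>l\<in>{1..c}. (indicator (P l) i * a i) * (indicator (P l) k * a k))
        = (\<Sum>l\<in>{1..c}. indicator (P l) i * indicator (P l) k) * (a i * a k)"
      unfolding sum_distrib_right by (intro sum.cong refl) (simp only: mult_ac)
    then show "pair_prob S i k * (a i * a k) = r * (a i * a k)
          + (q - r) * (\<Sum>l\<in>{1..c}. (indicator (P l) i * a i) * (indicator (P l) k * a k))
          + (p - q) * (of_bool (i = k) * (a i * a k))"
      unfolding pair by (simp only: distrib_right mult.assoc)
  qed
  also have "\<dots> = r * (\<Sum>i\<in>UNIV. a i)\<^sup>2 + (q - r) * B + (p - q) * C"
  proof -
    have "(\<Sum>i\<in>UNIV. \<Sum>k\<in>UNIV. \<Sum>l\<in>{1..c}. (indicator (P l) i * a i) * (indicator (P l) k * a k))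
        = (\<Sum>l\<in>{1..c}. \<Sum>i\<in>UNIV. \<Sum>k\<in>UNIV. (indicator (P l) i * a i) * (indicator (P l) k * a k))"
      by (subst sum.swap[where B = "{1..c}"], subst sum.swap[where B = "{1..c}"]) (rule refl)
    also have "\<dots> = B"
      unfolding B_def block[symmetric] power2_eq_square sum_product by (rule refl)
    finally have 1: "(\<Sum>i\<in>UNIV. \<Sum>k\<in>UNIV. \<Sum>l\<in>{1..c}. (indicator (P l) i * a i) * (indicator (P l) k * a k)) = B" .
    have 2: "(\<Sum>i\<in>UNIV. \<Sum>k\<in>UNIV. of_bool (i = k) * (a i * a k)) = C"
      by (simp add: C_def of_bool_def if_distrib[of "\<lambda>z. z * _"] power2_eq_square cong: if_cong)
    show ?thesis
      unfolding sum.distrib sum_distrib_left[symmetric] 1 2 power2_eq_square sum_product ..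
  qed
  also have "\<dots> \<le> (p - q + real (card J) * (r - (r - q) / w')) * C"
  proof -
    have "(\<Sum>i\<in>UNIV. a i)\<^sup>2 = (\<Sum>i\<in>J. a i)\<^sup>2"
      using a by (intro arg_cong[where f = "\<lambda>z. z\<^sup>2"] sum.mono_neutral_right) auto
    also have "\<dots> \<le> (\<Sum>i\<in>J. (a i)\<^sup>2) * real (card J)"
      by (rule sum_squared_le_sum_of_squares)
    also have "(\<Sum>i\<in>J. (a i)\<^sup>2) = C"
      unfolding C_def using a by (intro sum.mono_neutral_left) auto
    finally have AC: "(\<Sum>i\<in>UNIV. a i)\<^sup>2 \<le> C * real (card J)" .
    have "(\<Sum>i\<in>UNIV. a i) = (\<Sum>l\<in>{1..c}. \<Sum>i\<in>P l. a i)"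
      unfolding cover[symmetric] using disj
      by (intro sum.UNION_disjoint) (auto simp: disjoint_family_on_def)
    also have "\<dots> = (\<Sum>l\<in>H. \<Sum>i\<in>P l. a i)"
      using a by (intro sum.mono_neutral_right) (auto simp: H_def intro!: sum.neutral)
    finally have "(\<Sum>i\<in>UNIV. a i)\<^sup>2 = (\<Sum>l\<in>H. \<Sum>i\<in>P l. a i)\<^sup>2" by simp
    also have "\<dots> \<le> (\<Sum>l\<in>H. (\<Sum>i\<in>P l. a i)\<^sup>2) * w'"
      unfolding hit H_def[symmetric] by (rule sum_squared_le_sum_of_squares)
    also have "\<dots> \<le> B * w'"
      unfolding B_def using w' by (intro mult_right_mono sum_mono2) (auto simp: H_def)
    finally have AB: "(\<Sum>i\<in>UNIV. a i)\<^sup>2 / w' \<le> B"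
      using w' by (simp add: field_simps)
    have "(r - q) * ((\<Sum>i\<in>UNIV. a i)\<^sup>2 / w') \<le> (r - q) * B"
      using AB qr by (intro mult_left_mono) auto
    then have "r * (\<Sum>i\<in>UNIV. a i)\<^sup>2 + (q - r) * B \<le> (r - (r - q) / w') * (\<Sum>i\<in>UNIV. a i)\<^sup>2"
      by (simp add: algebra_simps)
    also have "\<dots> \<le> (r - (r - q) / w') * (C * real (card J))"
      \<comment> \<open>Multiplying by this coefficient keeps the inequality because \<open>(r - q) / w' \<le> r - q \<le> r\<close>.\<close>
    proof (rule mult_left_mono[OF AC])
      have "(r - q) / w' \<le> (r - q) / 1"
        using w' qr by (intro divide_left_mono) auto
      then show "0 \<le> r - (r - q) / w'" using qr by simp
    qed
    finally show ?thesis by (simp add: algebra_simps)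
  qed
  also have "\<dots> = b * (\<Sum>i\<in>UNIV. incl_prob S i * (a i)\<^sup>2)"
    unfolding b[symmetric] incl C_def sum_distrib_left[symmetric] by simp
  finally show "measure_pmf.expectation S (\<lambda>T. (\<Sum>i\<in>T. a i)\<^sup>2) \<le> b * (\<Sum>i\<in>UNIV. incl_prob S i * (a i)\<^sup>2)" .
qed


section \<open>Samplings whose law depends on the cardinality only\<close>

text \<open>
  A carrier \<open>X\<close> is allowed so that the notion covers both doubly uniform samplings, where \<open>X\<close> is
  the whole type, and the nice sampling of a single block of a partition.
\<close>

definition exchangeable_on :: "'n set \<Rightarrow> 'n set pmf \<Rightarrow> bool" where
  "exchangeable_on X S \<longleftrightarrow> set_pmf S \<subseteq> Pow X \<and>
     (\<forall>T1 T2. T1 \<subseteq> X \<longrightarrow> T2 \<subseteq> X \<longrightarrow> card T1 = card T2 \<longrightarrow> pmf S T1 = pmf S T2)"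

lemma exchangeable_on_support: "exchangeable_on X S \<Longrightarrow> T \<in> set_pmf S \<Longrightarrow> T \<subseteq> X"
  unfolding exchangeable_on_def by blast

lemma exchangeable_on_pmf_eq:
  "\<lbrakk>exchangeable_on X S; T1 \<subseteq> X; T2 \<subseteq> X; card T1 = card T2\<rbrakk> \<Longrightarrow> pmf S T1 = pmf S T2"
  unfolding exchangeable_on_def by blast

lemma exchangeable_on_permute:
  fixes S :: "'n::finite set pmf"
  assumes ex: "exchangeable_on X S" and pi: "bij \<pi>" "\<pi> ` X = X"
  shows "map_pmf ((`) \<pi>) S = S"
proof (rule pmf_eqI)
  fix T
  have inj: "inj ((`) \<pi>)"
    by (rule injI) (simp add: pi bij_is_inj inj_image_eq_iff)
  obtain U where T: "T = \<pi> ` U"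
    using pi by (metis bij_is_surj surj_image_vimage_eq)
  have "pmf (map_pmf ((`) \<pi>) S) T = pmf S U"
    unfolding T by (rule pmf_map_inj'[OF inj])
  also have "\<dots> = pmf S T"
  proof (cases "U \<subseteq> X")
    case True
    then have "T \<subseteq> X" unfolding T using pi by blast
    moreover have "card T = card U"
      unfolding T using pi by (intro card_image inj_on_subset[OF bij_is_inj]) auto
    ultimately show ?thesis
      using exchangeable_on_pmf_eq[OF ex True] by simp
  next
    case False
    have "\<pi> ` U \<subseteq> \<pi> ` X \<longleftrightarrow> U \<subseteq> X"
      by (rule inj_image_subset_iff[OF bij_is_inj[OF pi(1)]])
    then have "\<not> T \<subseteq> X"
      using False pi(2) T by simp
    then show ?thesis
      using False exchangeable_on_support[OF ex] by (metis pmf_eq_0_set_pmf)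
  qed
  finally show "pmf (map_pmf ((`) \<pi>) S) T = pmf S T" .
qed

lemma pair_prob_permute:
  fixes S :: "'n::finite set pmf"
  assumes "exchangeable_on X S" "bij \<pi>" "\<pi> ` X = X"
  shows "pair_prob S (\<pi> i) (\<pi> k) = pair_prob S i k"
proof -
  have "pair_prob S (\<pi> i) (\<pi> k) = pair_prob (map_pmf ((`) \<pi>) S) (\<pi> i) (\<pi> k)"
    using exchangeable_on_permute[OF assms] by simp
  also have "\<dots> = pair_prob S i k"
    using assms(2) by (simp add: pair_prob_def bij_is_inj inj_image_mem_iff)
  finally show ?thesis .
qed

lemma bij_image_moving_pair:
  assumes "i \<in> X" "k \<in> X" "i' \<in> X" "k' \<in> X" "i = k \<longleftrightarrow> i' = k'"
  obtains \<pi> where "bij \<pi>" "\<pi> ` X = X" "\<pi> i = i'" "\<pi> k = k'"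
proof
  define \<sigma> where "\<sigma> = Transposition.transpose i i'"
  define \<pi> where "\<pi> = Transposition.transpose (\<sigma> k) k' \<circ> \<sigma>"
  have \<sigma>: "bij \<sigma>" "\<sigma> ` X = X"
    using assms by (auto simp: \<sigma>_def)
  have "\<sigma> k \<in> X" using \<sigma> assms by blast
  then have "Transposition.transpose (\<sigma> k) k' ` X = X" using assms by simp
  then show "bij \<pi>" "\<pi> ` X = X"
    unfolding \<pi>_def using \<sigma> by (auto intro: bij_comp simp flip: image_comp simp del: o_apply)
  have "\<sigma> i = i'" by (simp add: \<sigma>_def)
  then show "\<pi> k = k'" "\<pi> i = i'"
    using assms \<sigma> by (auto simp: \<pi>_def Transposition.transpose_def inj_eq dest: bij_is_inj)
qed

text \<open>
  Permutations of \<open>X\<close> act transitively on points and on ordered pairs of distinct points, so pair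
  probabilities depend only on whether the two indices coincide.
\<close>

lemma pair_prob_exchangeable:
  fixes S :: "'n::finite set pmf"
  assumes "exchangeable_on X S" "i \<in> X" "k \<in> X" "i' \<in> X" "k' \<in> X" "i = k \<longleftrightarrow> i' = k'"
  shows "pair_prob S i' k' = pair_prob S i k"
  using bij_image_moving_pair[OF assms(2-)] pair_prob_permute[OF assms(1)] by metis

text \<open>
  The inclusion probabilities always add up to the expected cardinality, and here they are equal.
\<close>

lemma exchangeable_incl_prob:
  fixes S :: "'n::finite set pmf"
  assumes ex: "exchangeable_on X S" and i: "i \<in> X"
  shows "incl_prob S i * real (card X) = measure_pmf.expectation S (\<lambda>T. real (card T))"
proof -
  have "measure_pmf.expectation S (\<lambda>T. real (card T)) = (\<Sum>k\<in>UNIV. incl_prob S k)"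
    using expectation_sum_sampled[of S "\<lambda>_. 1"] by simp
  also have "\<dots> = (\<Sum>k\<in>X. incl_prob S k)"
    using ex by (intro sum.mono_neutral_right)
      (auto simp: incl_prob_def measure_pmf_zero_iff dest: exchangeable_on_support)
  also have "\<dots> = (\<Sum>k\<in>X. incl_prob S i)"
    using pair_prob_exchangeable[OF ex i i]
    by (intro sum.cong) (simp_all add: pair_prob_diagonal)
  finally show ?thesis by (simp add: mult.commute)
qed

text \<open>
  Likewise the pair probabilities over all ordered pairs add up to the second moment of the
  cardinality. The diagonal accounts for the first moment, and the remaining
  \<open>|X| (|X| - 1)\<close> terms are equal.
\<close>

lemma exchangeable_pair_prob:
  fixes S :: "'n::finite set pmf"
  assumes ex: "exchangeable_on X S" and ik: "i \<in> X" "k \<in> X" "i \<noteq> k"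
  shows "pair_prob S i k * (real (card X) * (real (card X) - 1)) =
    measure_pmf.expectation S (\<lambda>T. (real (card T))\<^sup>2) - measure_pmf.expectation S (\<lambda>T. real (card T))"
proof -
  have zero: "pair_prob S g h = 0" if "g \<notin> X \<or> h \<notin> X" for g h
    using ex that by (auto simp: pair_prob_def measure_pmf_zero_iff dest: exchangeable_on_support)
  have "measure_pmf.expectation S (\<lambda>T. (real (card T))\<^sup>2) = (\<Sum>g\<in>UNIV. \<Sum>h\<in>UNIV. pair_prob S g h)"
    using expectation_sum_sampled_squared[of S "\<lambda>_. 1"] by simp
  also have "\<dots> = (\<Sum>g\<in>X. \<Sum>h\<in>X. pair_prob S g h)"
    using zero by (intro sum.mono_neutral_cong_right) (auto intro!: sum.neutral sum.mono_neutral_right)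
  also have "\<dots> = (\<Sum>g\<in>X. \<Sum>h\<in>X. pair_prob S i k + (if g = h then incl_prob S i - pair_prob S i k else 0))"
  proof (intro sum.cong refl)
    fix g h assume "g \<in> X" "h \<in> X"
    then show "pair_prob S g h = pair_prob S i k + (if g = h then incl_prob S i - pair_prob S i k else 0)"
      using pair_prob_exchangeable[OF ex ik(1,2), of g h] pair_prob_exchangeable[OF ex ik(1,1), of g h] ik
      by (cases "g = h") (simp_all add: pair_prob_diagonal)
  qed
  also have "\<dots> = real (card X) * real (card X) * pair_prob S i k
      + real (card X) * (incl_prob S i - pair_prob S i k)"
    by (simp add: sum.distrib algebra_simps)
  finally show ?thesis
    unfolding exchangeable_incl_prob[OF ex ik(1), symmetric] by (simp add: algebra_simps)
qed

lemma pair_count_cancel: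
  fixes n :: real
  assumes "n \<ge> 2"
  shows "x / n * (y / max (n - 1) 1) * (n * (n - 1)) = x * y"
proof -
  have "x / n * (y / (n - 1)) * (n * (n - 1)) = (x / n * n) * (y / (n - 1) * (n - 1))"
    by (simp only: mult_ac)
  then show ?thesis using assms by (simp add: max_absorb1)
qed

lemma exchangeable_on_doubly_uniform: "doubly_uniform S \<Longrightarrow> exchangeable_on UNIV S"
  unfolding doubly_uniform_def exchangeable_on_def by blast

lemma expectation_card_pos:
  fixes S :: "'n::finite set pmf"
  assumes "\<not> nil_sampling S"
  shows "measure_pmf.expectation S (\<lambda>T. real (card T)) > 0"
proof -
  obtain T where T: "T \<in> set_pmf S" "T \<noteq> {}"
    using assms unfolding nil_sampling_def prob_eq_1_support by blast
  have "0 < pmf S T * real (card T)"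
    using T by (simp add: pmf_positive card_gt_0_iff)
  also have "\<dots> \<le> (\<Sum>U\<in>UNIV. pmf S U * real (card U))"
    by (rule member_le_sum) auto
  also have "\<dots> = measure_pmf.expectation S (\<lambda>T. real (card T))"
    by (subst integral_measure_pmf[of UNIV]) auto
  finally show ?thesis .
qed

lemma expectation_card_le_square:
  fixes S :: "'n::finite set pmf"
  shows "measure_pmf.expectation S (\<lambda>T. real (card T)) \<le> measure_pmf.expectation S (\<lambda>T. (real (card T))\<^sup>2)"
  by (intro integral_mono integrable_sampling)
    (metis of_nat_mono of_nat_power power2_nat_le_imp_le le_square power2_eq_square)

text \<open>
  One block and \<open>r = q\<close>: the term with the block count cancels, and \<open>b = 1 + (|J| - 1) q / p\<close>.
\<close>

lemma overlap_bound_doubly_uniform: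
  fixes S :: "'n::finite set pmf"
  assumes du: "doubly_uniform S" and nil: "\<not> nil_sampling S"
  shows "overlap_bound S J (1 + (real (card J) - 1)
            * (measure_pmf.expectation S (\<lambda>T. (real (card T))\<^sup>2)
                 / measure_pmf.expectation S (\<lambda>T. real (card T)) - 1)
            / max (real CARD('n) - 1) 1)"
proof (cases "J = {}")
  case False
  let ?n = "real CARD('n)"
  define M1 where "M1 = measure_pmf.expectation S (\<lambda>T. real (card T))"
  define M2 where "M2 = measure_pmf.expectation S (\<lambda>T. (real (card T))\<^sup>2)"
  define p where "p = M1 / ?n"
  define t where "t = (M2 / M1 - 1) / max (?n - 1) 1"
  define q where "q = p * t"
  have M: "M1 > 0" "M1 \<le> M2"
    unfolding M1_def M2_def by (rule expectation_card_pos[OF nil] expectation_card_le_square)+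
  note ex = exchangeable_on_doubly_uniform[OF du]
  show ?thesis
  proof (rule overlap_bound_blocks[where c = 1 and s = "CARD('n)" and P = "\<lambda>_. UNIV" and p = p and q = q and r = q, OF _ _ _ _ _ _ refl])
    show "equal_partition 1 CARD('n) (\<lambda>_. UNIV :: 'n set)"
      by (simp add: equal_partition_def disjoint_family_on_def)
    show "incl_prob S i = p" for i
      using exchangeable_incl_prob[OF ex, of i] by (simp add: p_def M1_def field_simps)
    show "pair_prob S i k = q" if "i \<noteq> k" for i k
    proof -
      have "card {i, k} \<le> CARD('n)" by (intro card_mono) auto
      then have n: "?n \<ge> 2" using that by simp
      have "pair_prob S i k * (?n * (?n - 1)) = M2 - M1"
        using exchangeable_pair_prob[OF ex _ _ that] by (simp add: M1_def M2_def)
      also have "\<dots> = q * (?n * (?n - 1))"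
        unfolding q_def t_def p_def pair_count_cancel[OF n] using M by (simp add: right_diff_distrib)
      finally show ?thesis
        using n by (subst (asm) mult_right_cancel) auto
    qed
    show "0 \<le> q"
      unfolding q_def t_def p_def using M by (intro mult_nonneg_nonneg divide_nonneg_nonneg) auto
    show "p * (1 + (real (card J) - 1)
            * (measure_pmf.expectation S (\<lambda>T. (real (card T))\<^sup>2)
                 / measure_pmf.expectation S (\<lambda>T. real (card T)) - 1)
            / max (?n - 1) 1) =
        p - q + real (card J) * (q - (q - q) / real (card {l \<in> {1..1::nat}. UNIV \<inter> J \<noteq> {}}))"
    proof -
      have eq: "(real (card J) - 1) * (M2 / M1 - 1) / max (?n - 1) 1 = (real (card J) - 1) * t"
        by (simp add: t_def)
      show ?thesis
        unfolding q_def M1_def[symmetric] M2_def[symmetric] eq by (simp add: algebra_simps)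
    qed
  qed (use False in auto)
qed (simp add: overlap_bound_empty)


section \<open>Nice and distributed samplings\<close>

lemma nice_sampling_outcomes_nonempty:
  assumes "finite X" "\<tau> \<le> card X"
  shows "{T. T \<subseteq> X \<and> card T = \<tau>} \<noteq> {}"
  using obtain_subset_with_card_n[OF assms(2)] by auto

lemma set_pmf_nice_sampling:
  assumes "finite X" "\<tau> \<le> card X"
  shows "set_pmf (nice_sampling X \<tau>) = {T. T \<subseteq> X \<and> card T = \<tau>}"
  unfolding nice_sampling_def using assms by (intro set_pmf_of_set nice_sampling_outcomes_nonempty) auto

lemma exchangeable_on_nice_sampling:
  assumes "finite X" "\<tau> \<le> card X"
  shows "exchangeable_on X (nice_sampling X \<tau>)"
  using assms nice_sampling_outcomes_nonempty[OF assms] set_pmf_nice_sampling[OF assms]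
  by (auto simp: exchangeable_on_def nice_sampling_def indicator_def)

lemma expectation_card_nice_sampling:
  fixes g :: "nat \<Rightarrow> real"
  assumes "finite X" "\<tau> \<le> card X"
  shows "measure_pmf.expectation (nice_sampling X \<tau>) (\<lambda>T. g (card T)) = g \<tau>"
proof -
  have "measure_pmf.expectation (nice_sampling X \<tau>) (\<lambda>T. g (card T)) =
      measure_pmf.expectation (nice_sampling X \<tau>) (\<lambda>T. g \<tau>)"
    by (intro integral_cong_AE) (auto simp: AE_measure_pmf_iff set_pmf_nice_sampling[OF assms])
  then show ?thesis by simp
qed

lemma nice_sampling_incl_prob:
  fixes X :: "'n::finite set"
  assumes "\<tau> \<le> card X" "i \<in> X"
  shows "incl_prob (nice_sampling X \<tau>) i = real \<tau> / real (card X)"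
proof -
  have "card X > 0" using assms by (auto simp: card_gt_0_iff)
  moreover have "incl_prob (nice_sampling X \<tau>) i * real (card X) = real \<tau>"
    using exchangeable_incl_prob[OF exchangeable_on_nice_sampling[OF finite assms(1)] assms(2)]
      expectation_card_nice_sampling[OF finite assms(1), of real]
    by simp
  ultimately show ?thesis
    by (auto simp: eq_divide_eq)
qed

lemma nice_sampling_pair_prob:
  fixes X :: "'n::finite set"
  assumes "\<tau> \<le> card X" "i \<in> X" "k \<in> X" "i \<noteq> k"
  shows "pair_prob (nice_sampling X \<tau>) i k =
    real \<tau> / real (card X) * ((real \<tau> - 1) / max (real (card X) - 1) 1)"
proof -
  have "card {i, k} \<le> card X" using assms by (intro card_mono) auto
  then have X: "real (card X) \<ge> 2" using assms by simp
  have "pair_prob (nice_sampling X \<tau>) i k * (real (card X) * (real (card X) - 1)) = (real \<tau>)\<^sup>2 - real \<tau>"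
    using exchangeable_pair_prob[OF exchangeable_on_nice_sampling[OF finite assms(1)] assms(2-)]
      expectation_card_nice_sampling[OF finite assms(1), of real]
      expectation_card_nice_sampling[OF finite assms(1), of "\<lambda>t. (real t)\<^sup>2"]
    by simp
  also have "\<dots> = real \<tau> / real (card X) * ((real \<tau> - 1) / max (real (card X) - 1) 1)
      * (real (card X) * (real (card X) - 1))"
    unfolding pair_count_cancel[OF X] by (simp add: power2_eq_square right_diff_distrib)
  finally show ?thesis
    using X by (subst (asm) mult_right_cancel) auto
qed

text \<open>
  Almost surely each component stays inside its block, so an index of block \<open>l\<close> is sampled iff
  component \<open>l\<close> contains it. The event is then a product event, and both the case of one block
  and the case of two blocks are read off the product formula.
\<close>

lemma distributed_sampling_pair_prob:
  fixes P :: "nat \<Rightarrow> 'n::finite set"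
  assumes part: "equal_partition c s P" and \<tau>: "\<tau> \<le> s"
    and i: "l \<in> {1..c}" "i \<in> P l" and k: "l' \<in> {1..c}" "k \<in> P l'"
  shows "pair_prob (distributed_sampling c P \<tau>) i k =
    (if l = l' then pair_prob (nice_sampling (P l) \<tau>) i k
     else incl_prob (nice_sampling (P l) \<tau>) i * incl_prob (nice_sampling (P l') \<tau>) k)"
proof -
  let ?N = "\<lambda>m. nice_sampling (P m) \<tau>"
  let ?B = "\<lambda>m. {T. (m = l \<longrightarrow> i \<in> T) \<and> (m = l' \<longrightarrow> k \<in> T)}"
  let ?D = "Pi_pmf {1..c} {} ?N"
  have disj: "m = m'" if "m \<in> {1..c}" "m' \<in> {1..c}" "h \<in> P m" "h \<in> P m'" for m m' h
    using part that unfolding equal_partition_def disjoint_family_on_def by blast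
  have mem: "(h \<in> (\<Union>m\<in>{1..c}. F m)) = (h \<in> F m)"
    if F: "F \<in> set_pmf ?D" and m: "m \<in> {1..c}" "h \<in> P m" for F h m
  proof -
    have "F m' \<subseteq> P m'" if "m' \<in> {1..c}" for m'
      using F that part \<tau> by (auto simp: set_Pi_pmf PiE_dflt_def set_pmf_nice_sampling equal_partition_def)
    then show ?thesis using disj m by blast
  qed
  have "pair_prob (distributed_sampling c P \<tau>) i k =
      measure_pmf.prob ?D {F. i \<in> (\<Union>m\<in>{1..c}. F m) \<and> k \<in> (\<Union>m\<in>{1..c}. F m)}"
    by (simp add: pair_prob_def distributed_sampling_def vimage_def)
  also have "\<dots> = measure_pmf.prob ?D (Pi {1..c} ?B)"
  proof (rule measure_pmf.finite_measure_eq_AE)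
    show "AE F in ?D. F \<in> {F. i \<in> (\<Union>m\<in>{1..c}. F m) \<and> k \<in> (\<Union>m\<in>{1..c}. F m)} \<longleftrightarrow> F \<in> Pi {1..c} ?B"
      unfolding AE_measure_pmf_iff mem_Collect_eq Pi_iff using mem i k by metis
  qed simp_all
  also have "\<dots> = (\<Prod>m\<in>{1..c}. measure_pmf.prob (?N m) (?B m))"
    by (rule measure_Pi_pmf_Pi) simp
  also have "\<dots> = (\<Prod>m\<in>{l, l'}. measure_pmf.prob (?N m) (?B m))"
    using i k by (intro prod.mono_neutral_right) auto
  also have "\<dots> = (if l = l' then pair_prob (?N l) i k else incl_prob (?N l) i * incl_prob (?N l') k)"
    by (auto simp: pair_prob_def incl_prob_def)
  finally show ?thesis .
qed

text \<open>
  This is the inequality \<open>q \<le> r\<close> for distributed samplings divided by \<open>p\<close>: inside a block, sampling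
  without replacement makes two inclusions negatively correlated.
\<close>

lemma nice_ratio_le:
  assumes "1 \<le> \<tau>" "\<tau> \<le> s"
  shows "(real \<tau> - 1) / max (real s - 1) 1 \<le> real \<tau> / real s"
proof (cases "s = 1")
  case False
  then have "max (real s - 1) 1 = real s - 1" "real s > 1" using assms by auto
  then show ?thesis using assms by (simp add: field_simps)
qed (use assms in auto)

lemma overlap_bound_distributed:
  fixes P :: "nat \<Rightarrow> 'n::finite set"
  assumes part: "equal_partition c s P" and \<tau>: "1 \<le> \<tau>" "\<tau> \<le> s"
    and s1: "s1 = max (real s - 1) 1"
    and w': "w' = real (card {l \<in> {1..c}. P l \<inter> J \<noteq> {}})"
  shows "overlap_bound (distributed_sampling c P \<tau>) J
    (1 + (real (card J) - 1) * (real \<tau> - 1) / s1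
       + real (card J) * (real \<tau> / real s - (real \<tau> - 1) / s1) * ((w' - 1) / w'))"
proof (cases "J = {}")
  case False
  let ?S = "distributed_sampling c P \<tau>"
  define p where "p = real \<tau> / real s"
  define r where "r = (real \<tau> - 1) / s1"
  have rp: "0 \<le> r" "r \<le> p" "0 \<le> p"
    using nice_ratio_le[OF \<tau>] \<tau> by (auto simp: r_def p_def s1)
  have card: "card (P l) = s" if "l \<in> {1..c}" for l
    using part that by (auto simp: equal_partition_def)
  have cover: "(\<Union>l\<in>{1..c}. P l) = UNIV"
    using part by (auto simp: equal_partition_def)
  have "{l \<in> {1..c}. P l \<inter> J \<noteq> {}} \<noteq> {}"
    using False cover by blast
  then have "w' \<noteq> 0" unfolding w' by simp
  show ?thesis
  proof (rule overlap_bound_blocks[OF part, where p = p and q = "p * r" and r = "p * p", OF _ _ _ _ _ w'])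
    fix i
    obtain l where "l \<in> {1..c}" "i \<in> P l" using cover by blast
    then show "incl_prob ?S i = p"
      using distributed_sampling_pair_prob[OF part \<tau>(2), of l i l i] nice_sampling_incl_prob[of \<tau> "P l" i]
        card \<tau> by (simp add: pair_prob_diagonal p_def)
  next
    fix i k l assume "i \<noteq> k" "l \<in> {1..c}" "i \<in> P l" "k \<in> P l"
    then show "pair_prob ?S i k = p * r"
      using distributed_sampling_pair_prob[OF part \<tau>(2), of l i l k] nice_sampling_pair_prob[of \<tau> "P l" i k]
        card \<tau> by (simp add: p_def r_def s1)
  next
    fix i k l l' assume "l \<noteq> l'" "l \<in> {1..c}" "l' \<in> {1..c}" "i \<in> P l" "k \<in> P l'"
    then show "pair_prob ?S i k = p * p"
      using distributed_sampling_pair_prob[OF part \<tau>(2), of l i l' k]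
        nice_sampling_incl_prob[of \<tau> "P l" i] nice_sampling_incl_prob[of \<tau> "P l'" k]
        card \<tau> by (simp add: p_def)
  next
    show "0 \<le> p * r" "p * r \<le> p * p"
      using rp by (auto intro: mult_left_mono)
    show "p * (1 + (real (card J) - 1) * (real \<tau> - 1) / s1
       + real (card J) * (real \<tau> / real s - (real \<tau> - 1) / s1) * ((w' - 1) / w')) =
       p - p * r + real (card J) * (p * p - (p * p - p * r) / w')"
    proof -
      have eq: "(real (card J) - 1) * (real \<tau> - 1) / s1 = (real (card J) - 1) * r"
        by (simp add: r_def)
      show ?thesis
        unfolding eq p_def[symmetric] r_def[symmetric] using \<open>w' \<noteq> 0\<close> by (simp add: field_simps)
    qed
  qed fact
qed (simp add: overlap_bound_empty)

lemma doubly_uniform_nice_sampling: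
  assumes "\<tau> \<le> CARD('n)"
  shows "doubly_uniform (nice_sampling (UNIV :: 'n::finite set) \<tau>)"
  unfolding doubly_uniform_def
  by (intro allI impI exchangeable_on_pmf_eq[OF exchangeable_on_nice_sampling[OF finite assms]]) simp_all

lemma not_nil_nice_sampling:
  assumes "1 \<le> \<tau>" "\<tau> \<le> CARD('n)"
  shows "\<not> nil_sampling (nice_sampling (UNIV :: 'n::finite set) \<tau>)"
  using nice_sampling_outcomes_nonempty[of "UNIV :: 'n set" \<tau>] assms
  unfolding nil_sampling_def prob_eq_1_support by (auto simp: set_pmf_nice_sampling)

lemma v_doubly_uniform_nice_sampling:
  fixes A :: "real ^ 'n ^ 'm"
  assumes "1 \<le> \<tau>" "\<tau> \<le> CARD('n)"
  shows "v_doubly_uniform A (nice_sampling UNIV \<tau>) = v_nice A \<tau>"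
  using assms expectation_card_nice_sampling[of "UNIV :: 'n set" \<tau> real]
    expectation_card_nice_sampling[of "UNIV :: 'n set" \<tau> "\<lambda>t. (real t)\<^sup>2"]
  by (simp add: v_doubly_uniform_def v_nice_def power2_eq_square)


section \<open>The six choices of sampling\<close>

theorem proposition5p1:
  fixes f :: "real ^ 'n \<Rightarrow> real" and A :: "real ^ 'n ^ 'm" and S :: "'n set pmf"
  assumes "\<forall>x. f differentiable (at x)"
    and "\<forall>x h. f (x + h) \<le> f x + grad f x \<bullet> h + 1 / 2 * (h \<bullet> ((transpose A ** A) *v h))"
  shows
    "(\<forall>\<tau>. measure_pmf.prob S {T. card T \<le> \<tau>} = 1 \<longrightarrow>
        ESO_inequality f S (v_bounded A \<tau>) \<and>
        ((\<forall>i. column i A \<noteq> 0) \<and> 1 \<le> \<tau> \<longrightarrow> ESO f S (v_bounded A \<tau>)))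
     \<and> (\<forall>c s P \<tau>. equal_partition c s P \<and> 1 \<le> \<tau> \<and> \<tau> \<le> s \<and> S = distributed_sampling c P \<tau> \<longrightarrow>
        ESO_inequality f S (v_distributed A c s P \<tau>) \<and>
        ((\<forall>i. column i A \<noteq> 0) \<longrightarrow> ESO f S (v_distributed A c s P \<tau>)))
     \<and> (\<forall>\<tau>. 1 \<le> \<tau> \<and> \<tau> \<le> CARD('n) \<and> S = nice_sampling UNIV \<tau> \<longrightarrow>
        ESO_inequality f S (v_nice A \<tau>) \<and>
        ((\<forall>i. column i A \<noteq> 0) \<longrightarrow> ESO f S (v_nice A \<tau>)))
     \<and> (doubly_uniform S \<and> \<not> nil_sampling S \<longrightarrow>
        ESO_inequality f S (v_doubly_uniform A S) \<and>
        ((\<forall>i. column i A \<noteq> 0) \<longrightarrow> ESO f S (v_doubly_uniform A S)))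
     \<and> (graph_sampling A S \<longrightarrow>
        ESO_inequality f S (v_column A) \<and>
        ((\<forall>i. column i A \<noteq> 0) \<longrightarrow> ESO f S (v_column A)))
     \<and> (serial_sampling S \<longrightarrow>
        ESO_inequality f S (v_column A) \<and>
        ((\<forall>i. column i A \<noteq> 0) \<longrightarrow> ESO f S (v_column A)))"
proof (intro conjI allI impI)
  have smooth: "f (x + h) \<le> f x + grad f x \<bullet> h + 1 / 2 * (h \<bullet> ((transpose A ** A) *v h))" for x h
    using assms(2) by blast
  note ESO = ESO_of_overlap_bounds[OF smooth]
  have card_pos: "real (card (row_supp A j)) \<ge> 1" if "row_supp A j \<noteq> {}" for j
    using that by (simp add: Suc_le_eq card_gt_0_iff)
  {
    fix \<tau> assume "measure_pmf.prob S {T. card T \<le> \<tau>} = 1"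
    then have "real (card (T \<inter> row_supp A j)) \<le> min (real (card (row_supp A j))) (real \<tau>)"
      if "T \<in> set_pmf S" for T j
      using that card_mono[of T "T \<inter> row_supp A j"] card_mono[of "row_supp A j" "T \<inter> row_supp A j"]
      by (force simp: prob_eq_1_support)
    note rows = ESO[OF overlap_bound_of_card_inter_le[OF this] v_bounded_def]
    show "ESO_inequality f S (v_bounded A \<tau>)"
      by (rule rows)
    show "ESO f S (v_bounded A \<tau>)" if "(\<forall>i. column i A \<noteq> 0) \<and> 1 \<le> \<tau>"
      using rows(2) that card_pos by fastforce
  }
  {
    fix c s P \<tau> assume *: "equal_partition c s P \<and> 1 \<le> \<tau> \<and> \<tau> \<le> s \<and> S = distributed_sampling c P \<tau>"
    define b where "b j = (let s1 = max (real s - 1) 1; w = real (card (row_supp A j));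
        w' = real (parts_hit A c P j)
      in 1 + (w - 1) * (real \<tau> - 1) / s1
           + w * (real \<tau> / real s - (real \<tau> - 1) / s1) * ((w' - 1) / w'))" for j
    have "overlap_bound S (row_supp A j) (b j)" for j
      using * overlap_bound_distributed[OF _ _ _ refl refl, of c s P \<tau> "row_supp A j"]
      by (simp add: b_def parts_hit_def Let_def)
    note rows = ESO[OF this v_distributed_def[of A c s P \<tau>, folded b_def]]
    show "ESO_inequality f S (v_distributed A c s P \<tau>)"
      by (rule rows)
    \<comment> \<open>For a nonempty row all three factors of the last term of the weight are nonnegative, so the
      weight is at least 1.\<close>
    have "b j > 0" if "row_supp A j \<noteq> {}" for j
    proof -
      have "{l \<in> {1..c}. P l \<inter> row_supp A j \<noteq> {}} \<noteq> {}"
        using that * unfolding equal_partition_def by blast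
      then have "real (parts_hit A c P j) \<ge> 1"
        unfolding parts_hit_def by (simp add: Suc_le_eq card_gt_0_iff)
      then show ?thesis
        unfolding b_def Let_def using card_pos[OF that] nice_ratio_le[of \<tau> s] *
        by (intro add_pos_nonneg mult_nonneg_nonneg divide_nonneg_nonneg) auto
    qed
    then show "ESO f S (v_distributed A c s P \<tau>)" if "\<forall>i. column i A \<noteq> 0"
      using rows(2) that by blast
  }
  \<comment> \<open>Kept as a fact because the nice sampling is a special case.\<close>
  have du: "ESO_inequality f S (v_doubly_uniform A S)"
      "\<forall>i. column i A \<noteq> 0 \<Longrightarrow> ESO f S (v_doubly_uniform A S)"
    if S: "doubly_uniform S \<and> \<not> nil_sampling S"
  proof -
    have "overlap_bound S (row_supp A j) (1 + (real (card (row_supp A j)) - 1)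
            * (measure_pmf.expectation S (\<lambda>T. (real (card T))\<^sup>2)
                 / measure_pmf.expectation S (\<lambda>T. real (card T)) - 1)
            / max (real CARD('n) - 1) 1)" for j
      using S by (intro overlap_bound_doubly_uniform) auto
    note rows = ESO[OF this v_doubly_uniform_def]
    show "ESO_inequality f S (v_doubly_uniform A S)"
      by (rule rows)
    have ratio: "measure_pmf.expectation S (\<lambda>T. (real (card T))\<^sup>2)
        / measure_pmf.expectation S (\<lambda>T. real (card T)) \<ge> 1"
      using expectation_card_pos[of S] S expectation_card_le_square[of S] by (simp add: le_divide_eq_1)
    show "ESO f S (v_doubly_uniform A S)" if "\<forall>i. column i A \<noteq> 0"
      using card_pos ratio that
      by (intro rows(2) add_pos_nonneg mult_nonneg_nonneg divide_nonneg_nonneg) auto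
  qed
  then show "ESO_inequality f S (v_doubly_uniform A S)"
    and "\<forall>i. column i A \<noteq> 0 \<Longrightarrow> ESO f S (v_doubly_uniform A S)"
    if "doubly_uniform S \<and> \<not> nil_sampling S"
    using that by blast+
  show "ESO_inequality f S (v_nice A \<tau>)"
    and "\<forall>i. column i A \<noteq> 0 \<Longrightarrow> ESO f S (v_nice A \<tau>)"
    if "1 \<le> \<tau> \<and> \<tau> \<le> CARD('n) \<and> S = nice_sampling UNIV \<tau>" for \<tau>
    using du doubly_uniform_nice_sampling[where 'n = 'n] not_nil_nice_sampling[where 'n = 'n]
      v_doubly_uniform_nice_sampling[of \<tau> A] that by auto
  have column: "v_column A = (\<chi> i. \<Sum>j\<in>UNIV. 1 * (A $ j $ i)\<^sup>2)"
    by (simp add: v_column_def)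
  show "ESO_inequality f S (v_column A)"
    and "\<forall>i. column i A \<noteq> 0 \<Longrightarrow> ESO f S (v_column A)" if "graph_sampling A S"
    using ESO[OF overlap_bound_graph_sampling[OF that] column] by auto
  show "ESO_inequality f S (v_column A)"
    and "\<forall>i. column i A \<noteq> 0 \<Longrightarrow> ESO f S (v_column A)" if serial: "serial_sampling S"
  proof -
    have "real (card (T \<inter> row_supp A j)) \<le> 1" if "T \<in> set_pmf S" for T j
      using serial that card_mono[of T "T \<inter> row_supp A j"]
      by (force simp: serial_sampling_def prob_eq_1_support)
    note rows = ESO[OF overlap_bound_of_card_inter_le[OF this] column]
    show "ESO_inequality f S (v_column A)"
      and "\<forall>i. column i A \<noteq> 0 \<Longrightarrow> ESO f S (v_column A)"
      using rows by auto
  qed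
qed

end
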